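(* Let $G$ be a summary graph with node set $N$ and ordered split $N=(u,v)$, and let $s\neq t$ be two nodes of $N$. Put $N'=N\setminus\{s,t\}$, let $d_s$ be the set of ancestors of $s$ in $G$ that lie in $u$ (so $d_s=\varnothing$ if $s\in v$), and put $v'=(v\cup d_s)\setminus\{s,t\}$, $u'=N'\setminus v'$. Let $G'$ be the graph produced from $G$ by the following procedure. (1) First, for every pair of distinct neighbours $i,k$ of $t$, insert the edges prescribed by the marginalising rules (with inner node $t$). Second, ignoring all edges that involve $t$, take the nodes $j\neq t$ that equal $s$ or are ancestors of $s$ in $G$ one after another and, for every pair of distinct neighbours $i,k$ of $j$, insert the edges prescribed by the conditioning rules (with inner node $j$), edges already inserted being taken into account. (2) Change every edge present within $v'$ into a full line, and every edge present between $u'$ and $v'$ into an arrow pointing from $v'$ to $u'$. (3) For each node pair keep only one of several edges of the same kind, and delete the nodes $s,t$ and all edges involving $s$ or $t$. Then $G'$ is an independence-preserving summary graph with node set $N'=(u',v')$ for marginalising over $t$ and conditioning on $s$: $G'$ is a summary graph and, for all pairwise disjoint $\alpha,\beta,c\subseteq N'$ with $\alpha,\beta$ non-empty, $$G' \text{ implies } \alpha\perp\!\!\!\perp\beta\mid c\quad\Longleftrightarrow\quad G\text{ implies }\alpha\perp\!\!\!\perp\beta\mid c\cup\{s\}.$$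
   Context: Summary graph. A graph on a finite node set $N$ with an ordered partition $N=(u,v)$ (one part may be empty) and three kinds of edges: arrows $i\leftarrow k$, dashed lines $i\,\text{- -}\,k$, and full lines $i\,\text{---}\,k$. Within $u$ the graph consists of a directed acyclic graph (arrows) together with a covariance graph (dashed lines), so that a pair in $u$ may be coupled by an arrow, a dashed line, or both. Within $v$ there are only full lines. Between $u$ and $v$ there are only arrows, pointing from $v$ to $u$. There are no loops. If $i\leftarrow k$, then $k$ is a parent of $i$. If there is a directed path of arrows from $k$ all pointing towards $i$, then $k$ is an ancestor of $i$ and $i$ a descendant of $k$. Two nodes are neighbours if they are coupled by at least one edge. Paths. A path connects its endpoints by a sequence of edges with distinct inner nodes; a single edge is a path without inner nodes. An inner node $j$ of a path, with adjacent path edges to $i$ and $k$, is a collision node if the two edges are $i\to j\leftarrow k$, or $i\to j\,\text{- -}\,k$ (or its mirror image), or $i\,\text{- -}\,j\,\text{- -}\,k$; otherwise it is a transmitting node. Independence statements implied by a summary graph. For pairwise disjoint $\alpha,\beta,c\subseteq N$ with $\alpha,\beta\neq\varnothing$, the graph implies $\alpha\perp\!\!\!\perp\beta\mid c$ if and only if there is no path between a node of $\alpha$ and a node of $\beta$ such that every inner collision node is in $c$ or has a descendant in $c$ and every other inner node is outside $c$. Marginalising rules (inner node $t$ transmitting), each also in mirror image: $i\leftarrow t\to k$ induces $i\,\text{- -}\,k$; $i\leftarrow t\,\text{---}\,k$ induces $i\leftarrow k$; $i\leftarrow t\leftarrow k$ induces $i\leftarrow k$; $i\leftarrow t\,\text{-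 -}\,k$ induces $i\,\text{- -}\,k$; $i\,\text{---}\,t\,\text{---}\,k$ induces $i\,\text{---}\,k$; $i\,\text{---}\,t\leftarrow k$ induces $i\,\text{---}\,k$; $i\,\text{---}\,t\,\text{- -}\,k$ induces $i\to k$. Conditioning rules (inner node $j$ a collision node), each also in mirror image: $i\to j\leftarrow k$ induces $i\,\text{---}\,k$; $i\to j\,\text{- -}\,k$ induces $i\to k$; $i\,\text{- -}\,j\,\text{- -}\,k$ induces $i\,\text{- -}\,k$. *)

theory Defs
  imports Main
begin

text \<open>
  Graphs with three kinds of edges. An arrow \<open>k \<rightarrow> i\<close> is the pair \<open>(k, i)\<close>. The undirected kinds,
  dashed and full lines, are relations that are required to be symmetric. Since the edges are sets,
  a node pair never carries two edges of the same kind.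
\<close>

record 'a mgraph =
  nodes :: "'a set"
  arrows :: "('a \<times> 'a) set"
  dashes :: "('a \<times> 'a) set"
  lines :: "('a \<times> 'a) set"

text \<open>
  The kind of an edge as it is met when it is traversed from its first to its second end:
  \<open>i \<rightarrow> k\<close>, \<open>i \<leftarrow> k\<close>, dashed, full.
\<close>

datatype edge = To | From | Dash | Line

fun mirror :: "edge \<Rightarrow> edge" where
  "mirror To = From"
| "mirror From = To"
| "mirror Dash = Dash"
| "mirror Line = Line"

fun has_edge :: "'a mgraph \<Rightarrow> 'a \<Rightarrow> edge \<Rightarrow> 'a \<Rightarrow> bool" where
  "has_edge G i To k \<longleftrightarrow> (i, k) \<in> arrows G"
| "has_edge G i From k \<longleftrightarrow> (k, i) \<in> arrows G"
| "has_edge G i Dash k \<longleftrightarrow> (i, k) \<in> dashes G"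
| "has_edge G i Line k \<longleftrightarrow> (i, k) \<in> lines G"

definition neighbours :: "'a mgraph \<Rightarrow> 'a \<Rightarrow> 'a \<Rightarrow> bool" where
  "neighbours G i k \<longleftrightarrow> (\<exists>e. has_edge G i e k)"

definition ancestors :: "'a mgraph \<Rightarrow> 'a \<Rightarrow> 'a set" where
  "ancestors G i = {k. (k, i) \<in> (arrows G)\<^sup>+}"

definition descendants :: "'a mgraph \<Rightarrow> 'a \<Rightarrow> 'a set" where
  "descendants G k = {i. (k, i) \<in> (arrows G)\<^sup>+}"

definition summary_graph :: "'a set \<Rightarrow> 'a set \<Rightarrow> 'a mgraph \<Rightarrow> bool" where
  "summary_graph u v G \<longleftrightarrow>
     finite (nodes G) \<and> nodes G = u \<union> v \<and> u \<inter> v = {} \<and>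
     arrows G \<subseteq> u \<times> u \<union> v \<times> u \<and> acyclic (arrows G \<inter> u \<times> u) \<and>
     dashes G \<subseteq> u \<times> u \<and> sym (dashes G) \<and> irrefl (dashes G) \<and>
     lines G \<subseteq> v \<times> v \<and> sym (lines G) \<and> irrefl (lines G)"


text \<open>
  A path is given by its nodes \<open>p\<close> and its edges \<open>es\<close>, where the edge \<open>es ! m\<close> joins \<open>p ! m\<close> to
  \<open>p ! Suc m\<close>. The inner nodes are those at positions \<open>0 < m < length es\<close>.
\<close>

definition is_path :: "'a mgraph \<Rightarrow> 'a list \<Rightarrow> edge list \<Rightarrow> bool" where
  "is_path G p es \<longleftrightarrow>
     es \<noteq> [] \<and> length p = Suc (length es) \<and> distinct p \<and>
     (\<forall>m < length es. has_edge G (p ! m) (es ! m) (p ! Suc m))"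

definition collision :: "edge \<Rightarrow> edge \<Rightarrow> bool" where
  "collision e f \<longleftrightarrow> (e, f) \<in> {(To, From), (To, Dash), (Dash, From), (Dash, Dash)}"

definition connecting :: "'a mgraph \<Rightarrow> 'a set \<Rightarrow> 'a list \<Rightarrow> edge list \<Rightarrow> bool" where
  "connecting G c p es \<longleftrightarrow>
     (\<forall>m. 0 < m \<and> m < length es \<longrightarrow>
        (if collision (es ! (m - 1)) (es ! m)
         then p ! m \<in> c \<or> descendants G (p ! m) \<inter> c \<noteq> {}
         else p ! m \<notin> c))"

definition implies_indep :: "'a mgraph \<Rightarrow> 'a set \<Rightarrow> 'a set \<Rightarrow> 'a set \<Rightarrow> bool" where
  "implies_indep G \<alpha> \<beta> c \<longleftrightarrow>
     \<not> (\<exists>p es. is_path G p es \<and> hd p \<in> \<alpha> \<and> last p \<in> \<beta> \<and> connecting G c p es)"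


text \<open>
  \<open>marginalising e f g\<close>: an edge of kind \<open>e\<close> from \<open>i\<close> to the inner node, followed by an edge of kind
  \<open>f\<close> from the inner node to \<open>k\<close>, induces an edge of kind \<open>g\<close> from \<open>i\<close> to \<open>k\<close>. Likewise for
  \<open>conditioning\<close>.
\<close>

inductive marginalising :: "edge \<Rightarrow> edge \<Rightarrow> edge \<Rightarrow> bool" where
  "marginalising From To Dash"
| "marginalising From Line From"
| "marginalising From From From"
| "marginalising From Dash Dash"
| "marginalising Line Line Line"
| "marginalising Line From Line"
| "marginalising Line Dash To"
| "marginalising e f g \<Longrightarrow> marginalising (mirror f) (mirror e) (mirror g)"

inductive conditioning :: "edge \<Rightarrow> edge \<Rightarrow> edge \<Rightarrow> bool" where
  "conditioning To From Line"
| "conditioning To Dash To"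
| "conditioning Dash Dash Dash"
| "conditioning e f g \<Longrightarrow> conditioning (mirror f) (mirror e) (mirror g)"

definition induces ::
  "(edge \<Rightarrow> edge \<Rightarrow> edge \<Rightarrow> bool) \<Rightarrow> 'a set \<Rightarrow> 'a mgraph \<Rightarrow> 'a \<Rightarrow> 'a \<Rightarrow> edge \<Rightarrow> 'a \<Rightarrow> bool" where
  "induces R X G j i g k \<longleftrightarrow>
     i \<notin> X \<and> j \<notin> X \<and> k \<notin> X \<and> i \<noteq> k \<and>
     (\<exists>e f. has_edge G i e j \<and> has_edge G j f k \<and> R e f g)"

text \<open>
  Insert all edges prescribed by the rules \<open>R\<close> with inner node \<open>j\<close>, ignoring the edges that involve
  a node of \<open>X\<close>. Inserted edges do not involve \<open>j\<close>, so the neighbour pairs of \<open>j\<close> can be treated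
  simultaneously. An induced \<open>i \<leftarrow> k\<close> is covered by \<open>To\<close> for the pair \<open>(k, i)\<close>, because both rule
  sets are closed under mirror images.
\<close>

definition insert_induced ::
  "(edge \<Rightarrow> edge \<Rightarrow> edge \<Rightarrow> bool) \<Rightarrow> 'a set \<Rightarrow> 'a \<Rightarrow> 'a mgraph \<Rightarrow> 'a mgraph" where
  "insert_induced R X j G = G\<lparr>
     arrows := arrows G \<union> {(i, k). induces R X G j i To k},
     dashes := dashes G \<union> {(i, k). induces R X G j i Dash k},
     lines := lines G \<union> {(i, k). induces R X G j i Line k}\<rparr>"

text \<open>The list \<open>js\<close> is the order in which the inner nodes \<open>j\<close> are treated.\<close>

definition close_edges :: "'a \<Rightarrow> 'a list \<Rightarrow> 'a mgraph \<Rightarrow> 'a mgraph" where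
  "close_edges t js G =
     fold (insert_induced conditioning {t}) js (insert_induced marginalising {} t G)"

definition reorient :: "'a set \<Rightarrow> 'a set \<Rightarrow> 'a mgraph \<Rightarrow> 'a mgraph" where
  "reorient u v G =
     (let changed = v \<times> v \<union> u \<times> v \<union> v \<times> u in
      G\<lparr>arrows := (arrows G - changed) \<union> {(k, i). k \<in> v \<and> i \<in> u \<and> neighbours G k i},
        dashes := dashes G - changed,
        lines := (lines G - changed) \<union> {(i, k). i \<in> v \<and> k \<in> v \<and> neighbours G i k}\<rparr>)"

definition delete_nodes :: "'a set \<Rightarrow> 'a mgraph \<Rightarrow> 'a mgraph" where
  "delete_nodes X G =
     \<lparr>nodes = nodes G - X,
      arrows = {(k, i) \<in> arrows G. k \<notin> X \<and> i \<notin> X},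
      dashes = {(i, k) \<in> dashes G. i \<notin> X \<and> k \<notin> X},
      lines = {(i, k) \<in> lines G. i \<notin> X \<and> k \<notin> X}\<rparr>"

end

theory Submission
  imports Defs
begin

text \<open>
  An edge kind is a pair of end marks, head or tail. A collision is a pair of heads, and both rule
  sets keep the two outer marks, so they are the eliminations of a transmitting and of a collision
  node from a walk. Open paths may be replaced by open walks throughout. A walk of \<open>G\<close> is freed
  from \<open>t\<close> (an open collision at \<open>t\<close> is moved to a child of \<open>t\<close>) and then from the collisions at
  ancestors of \<open>s\<close>, which conditioning on \<open>s\<close> leaves open anyway. Conversely, the nodes that step
  (2) puts into \<open>v'\<close> transmit in \<open>G'\<close>, and in \<open>G\<close> they are open as soon as they are outside \<open>c\<close>,
  whatever the marks; at the nodes of \<open>u'\<close> the marks are not changed.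
\<close>

section \<open>Edges as pairs of end marks\<close>

fun edge_of :: "bool \<Rightarrow> bool \<Rightarrow> edge" where
  "edge_of False True = To"
| "edge_of True False = From"
| "edge_of True True = Dash"
| "edge_of False False = Line"

fun head1 :: "edge \<Rightarrow> bool" where
  "head1 To = False" | "head1 From = True" | "head1 Dash = True" | "head1 Line = False"

fun head2 :: "edge \<Rightarrow> bool" where
  "head2 To = True" | "head2 From = False" | "head2 Dash = True" | "head2 Line = False"

lemma edge_of_heads [simp]: "edge_of (head1 e) (head2 e) = e"
  by (cases e) auto

lemma heads_edge_of [simp]: "head1 (edge_of a b) = a" "head2 (edge_of a b) = b"
  by (cases a; cases b; simp)+

lemma collision_iff: "collision e f \<longleftrightarrow> head2 e \<and> head1 f"
  by (cases e; cases f) (auto simp: collision_def)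

lemma heads_mirror [simp]: "head1 (mirror e) = head2 e" "head2 (mirror e) = head1 e"
  by (cases e; simp)+

lemma marginalising_iff:
  "marginalising e f g \<longleftrightarrow> \<not> (head2 e \<and> head1 f) \<and> head1 g = head1 e \<and> head2 g = head2 f"
proof
  assume "marginalising e f g"
  then show "\<not> (head2 e \<and> head1 f) \<and> head1 g = head1 e \<and> head2 g = head2 f"
    by induction auto
next
  assume "\<not> (head2 e \<and> head1 f) \<and> head1 g = head1 e \<and> head2 g = head2 f"
  then show "marginalising e f g"
    using marginalising.intros(1-7) marginalising.intros(1-7)[THEN marginalising.intros(8)]
    by (cases e; cases f; cases g) auto
qed

lemma conditioning_iff:
  "conditioning e f g \<longleftrightarrow> head2 e \<and> head1 f \<and> head1 g = head1 e \<and> head2 g = head2 f"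
proof
  assume "conditioning e f g"
  then show "head2 e \<and> head1 f \<and> head1 g = head1 e \<and> head2 g = head2 f"
    by induction auto
next
  assume "head2 e \<and> head1 f \<and> head1 g = head1 e \<and> head2 g = head2 f"
  then show "conditioning e f g"
    using conditioning.intros(1-3) conditioning.intros(1-3)[THEN conditioning.intros(4)]
    by (cases e; cases f; cases g) auto
qed

text \<open>With the marks as arguments, mirroring exchanges the pairs \<open>(i, a)\<close> and
  \<open>(k, b)\<close>, and walks can also use relations that come from no \<open>mgraph\<close>,
  such as those with loops.\<close>

definition joined :: "'a mgraph \<Rightarrow> 'a \<Rightarrow> bool \<Rightarrow> 'a \<Rightarrow> bool \<Rightarrow> bool" where
  "joined G i a k b \<longleftrightarrow> has_edge G i (edge_of a b) k"

lemma has_edge_iff_joined: "has_edge G i e k \<longleftrightarrow> joined G i (head1 e) k (head2 e)"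
  by (simp add: joined_def)

lemma joined_simps:
  "joined G i False k True \<longleftrightarrow> (i, k) \<in> arrows G"
  "joined G i True k False \<longleftrightarrow> (k, i) \<in> arrows G"
  "joined G i True k True \<longleftrightarrow> (i, k) \<in> dashes G"
  "joined G i False k False \<longleftrightarrow> (i, k) \<in> lines G"
  by (auto simp: joined_def)

lemma ex_edge_iff: "(\<exists>e. P e) \<longleftrightarrow> (\<exists>a b. P (edge_of a b))"
  by (metis edge_of_heads)

lemma neighbours_iff_joined: "neighbours G i k \<longleftrightarrow> (\<exists>a b. joined G i a k b)"
  unfolding neighbours_def joined_def by (rule ex_edge_iff)

definition symmetric :: "('a \<Rightarrow> bool \<Rightarrow> 'a \<Rightarrow> bool \<Rightarrow> bool) \<Rightarrow> bool" where
  "symmetric R \<longleftrightarrow> (\<forall>i a k b. R i a k b \<longrightarrow> R k b i a)"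

lemma symmetricD: "symmetric R \<Longrightarrow> R i a k b \<Longrightarrow> R k b i a"
  unfolding symmetric_def by blast

lemma symmetric_joined_iff: "symmetric (joined G) \<longleftrightarrow> sym (dashes G) \<and> sym (lines G)"
  unfolding symmetric_def sym_def by (simp add: all_bool_eq joined_simps) blast

lemma induces_iff_joined:
  "induces R X G j i g k \<longleftrightarrow> i \<notin> X \<and> j \<notin> X \<and> k \<notin> X \<and> i \<noteq> k \<and>
     (\<exists>a m m' b. joined G i a j m \<and> joined G j m' k b \<and> R (edge_of a m) (edge_of m' b) g)"
  unfolding induces_def ex_edge_iff joined_def by blast

lemma induces_marginalising_iff:
  "induces marginalising X G j i (edge_of a b) k \<longleftrightarrow> i \<notin> X \<and> j \<notin> X \<and> k \<notin> X \<and> i \<noteq> k \<and>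
     (\<exists>m m'. joined G i a j m \<and> joined G j m' k b \<and> \<not> (m \<and> m'))"
  by (auto simp: induces_iff_joined marginalising_iff)

lemma induces_conditioning_iff:
  "induces conditioning X G j i (edge_of a b) k \<longleftrightarrow> i \<notin> X \<and> j \<notin> X \<and> k \<notin> X \<and> i \<noteq> k \<and>
     joined G i a j True \<and> joined G j True k b"
  by (auto simp: induces_iff_joined conditioning_iff)

text \<open>An arrow is stored only from tail to head, so reading an inserted one from its head asks
  for the rule of the reversed pair. The assumption supplies this.\<close>

lemma joined_insert_induced:
  assumes "induces R X G j i (edge_of True False) k \<longleftrightarrow> induces R X G j k (edge_of False True) i"
  shows "joined (insert_induced R X j G) i a k b \<longleftrightarrow>
    joined G i a k b \<or> induces R X G j i (edge_of a b) k"
  using assms by (cases a; cases b) (simp_all add: joined_simps insert_induced_def)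

lemma joined_insert_marginalising:
  assumes "symmetric (joined G)"
  shows "joined (insert_induced marginalising X j G) i a k b \<longleftrightarrow> joined G i a k b \<or>
    i \<notin> X \<and> j \<notin> X \<and> k \<notin> X \<and> i \<noteq> k \<and>
    (\<exists>m m'. joined G i a j m \<and> joined G j m' k b \<and> \<not> (m \<and> m'))"
proof (subst joined_insert_induced)
  show "induces marginalising X G j i (edge_of True False) k \<longleftrightarrow>
    induces marginalising X G j k (edge_of False True) i"
    unfolding induces_marginalising_iff using symmetricD[OF assms] by blast
qed (simp only: induces_marginalising_iff)

lemma joined_insert_conditioning:
  assumes "symmetric (joined G)"
  shows "joined (insert_induced conditioning X j G) i a k b \<longleftrightarrow> joined G i a k b \<or>
    i \<notin> X \<and> j \<notin> X \<and> k \<notin> X \<and> i \<noteq> k \<and> joined G i a j True \<and> joined G j True k b"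
proof (subst joined_insert_induced)
  show "induces conditioning X G j i (edge_of True False) k \<longleftrightarrow>
    induces conditioning X G j k (edge_of False True) i"
    unfolding induces_conditioning_iff using symmetricD[OF assms] by blast
qed (simp only: induces_conditioning_iff)

lemma symmetric_insert_marginalising:
  assumes "symmetric (joined G)"
  shows "symmetric (joined (insert_induced marginalising X j G))"
  using symmetricD[OF assms] unfolding symmetric_def joined_insert_marginalising[OF assms] by blast

lemma symmetric_insert_conditioning:
  assumes "symmetric (joined G)"
  shows "symmetric (joined (insert_induced conditioning X j G))"
  using symmetricD[OF assms] unfolding symmetric_def joined_insert_conditioning[OF assms] by blast

section \<open>Open walks\<close>

text \<open>\<open>A\<close> is where collisions are open, \<open>C\<close> is where transmission is
  blocked. Keeping the two sets independent lets the eliminations below shrink \<open>A\<close>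
  alone.\<close>

definition passable :: "'a set \<Rightarrow> 'a set \<Rightarrow> bool \<Rightarrow> 'a \<Rightarrow> bool \<Rightarrow> bool" where
  "passable A C b y m \<longleftrightarrow> (if b \<and> m then y \<in> A else y \<notin> C)"

inductive open_walk ::
  "('a \<Rightarrow> bool \<Rightarrow> 'a \<Rightarrow> bool \<Rightarrow> bool) \<Rightarrow> 'a set \<Rightarrow> 'a set \<Rightarrow> 'a \<Rightarrow> bool \<Rightarrow> 'a \<Rightarrow> bool \<Rightarrow> bool"
  for R A C x a where
  edge: "R x a y b \<Longrightarrow> open_walk R A C x a y b"
| snoc: "open_walk R A C x a y b \<Longrightarrow> passable A C b y m \<Longrightarrow> R y m z d \<Longrightarrow> open_walk R A C x a z d"

lemma open_walk_append:
  assumes "open_walk R A C y m z d" "open_walk R A C x a y b" "passable A C b y m"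
  shows "open_walk R A C x a z d"
  using assms by (induction) (blast intro: open_walk.intros)+

definition act :: "'a mgraph \<Rightarrow> 'a set \<Rightarrow> 'a set" where
  "act G c = {y. y \<in> c \<or> descendants G y \<inter> c \<noteq> {}}"

lemma act_iff: "y \<in> act G c \<longleftrightarrow> (\<exists>z \<in> c. (y, z) \<in> (arrows G)\<^sup>*)"
  unfolding act_def descendants_def by (auto simp: rtrancl_eq_or_trancl)

lemma open_walk_of_path:
  assumes "is_path G p es" "connecting G c p es" "n < length es"
  shows "open_walk (joined G) (act G c) c (p ! 0) (head1 (es ! 0)) (p ! Suc n) (head2 (es ! n))"
  using assms(3)
proof (induction n)
  case 0
  then show ?case
    using assms(1) by (auto simp: is_path_def has_edge_iff_joined intro!: open_walk.edge)
next
  case (Suc n)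
  have "joined G (p ! Suc n) (head1 (es ! Suc n)) (p ! Suc (Suc n)) (head2 (es ! Suc n))"
    using assms(1) Suc.prems by (auto simp: is_path_def has_edge_iff_joined)
  moreover have "passable (act G c) c (head2 (es ! n)) (p ! Suc n) (head1 (es ! Suc n))"
    using assms(2)[unfolded connecting_def, rule_format, of "Suc n"] Suc.prems
    by (auto simp: passable_def collision_iff act_def split: if_splits)
  ultimately show ?case
    using Suc by (auto intro: open_walk.snoc)
qed

section \<open>Node lists of walks and their conversion into paths\<close>

text \<open>The nodes are listed from the last one to the first one.\<close>

inductive walk_list ::
  "('a \<Rightarrow> bool \<Rightarrow> 'a \<Rightarrow> bool \<Rightarrow> bool) \<Rightarrow> 'a set \<Rightarrow> 'a set \<Rightarrow> 'a list \<Rightarrow> bool \<Rightarrow> bool"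
  for R A C where
  edge: "R x a y b \<Longrightarrow> walk_list R A C [y, x] b"
| snoc: "walk_list R A C (y # p) b \<Longrightarrow> passable A C b y m \<Longrightarrow> R y m z d \<Longrightarrow>
    walk_list R A C (z # y # p) d"

text \<open>Serves to cut out a closed part: the walk up to \<open>z\<close> survives and keeps its
  nodes; of the rest only openness and the outer marks matter.\<close>

lemma walk_list_split:
  assumes "walk_list R A C r b" "r = q @ z # p" "q \<noteq> []" "p \<noteq> []"
  shows "\<exists>m1 m2. walk_list R A C (z # p) m1 \<and> passable A C m1 z m2 \<and> open_walk R A C z m2 (hd q) b"
  using assms
proof (induction arbitrary: q)
  case (edge x a y b)
  then show ?case by (auto simp: Cons_eq_append_conv)
next
  case (snoc y p' b m w d)
  then obtain q' where q: "q = w # q'" "y # p' = q' @ z # p"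
    by (auto simp: Cons_eq_append_conv)
  show ?case
  proof (cases q')
    case Nil
    with q snoc show ?thesis by (auto intro: open_walk.edge)
  next
    case (Cons y' q'')
    with q(2) snoc.IH[of q'] snoc.prems obtain m1 m2 where
      *: "walk_list R A C (z # p) m1" "passable A C m1 z m2" "open_walk R A C z m2 y b"
      by auto
    with snoc.hyps have "open_walk R A C z m2 w d" by (auto intro: open_walk.snoc)
    with * q show ?thesis by auto
  qed
qed

text \<open>The mark of the last edge is carried along because the passability of \<open>y\<close>
  depends on it when the next edge is appended.\<close>

lemma path_of_walk_list:
  assumes "walk_list (joined G) (act G c) c p b" "distinct p"
  shows "\<exists>es. is_path G (rev p) es \<and> connecting G c (rev p) es \<and> head2 (last es) = b"
  using assms
proof (induction)
  case (edge x a y b)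
  then show ?case
    by (intro exI[of _ "[edge_of a b]"]) (auto simp: is_path_def connecting_def joined_def)
next
  case (snoc y p b m z d)
  then obtain es where es: "is_path G (rev (y # p)) es" "connecting G c (rev (y # p)) es"
    "head2 (last es) = b" by auto
  let ?es = "es @ [edge_of m d]"
  have len: "length es = length p" "es \<noteq> []" using es(1) by (auto simp: is_path_def)
  have nth: "rev (z # y # p) ! n = rev (y # p) ! n" if "n \<le> length es" for n
    using that len by (simp add: nth_append)
  have last: "rev (y # p) ! length es = y" "rev (z # y # p) ! Suc (length es) = z"
    using len by (auto simp: nth_append)
  have "is_path G (rev (z # y # p)) ?es"
    unfolding is_path_def
  proof (intro conjI allI impI)
    fix n assume "n < length ?es"
    then consider "n < length es" | "n = length es" by fastforce
    then show "has_edge G (rev (z # y # p) ! n) (?es ! n) (rev (z # y # p) ! Suc n)"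
    proof cases
      case 1
      with es(1) show ?thesis
        using nth[of n] nth[of "Suc n"] by (auto simp: is_path_def nth_append[of es])
    next
      case 2
      with snoc.hyps(3) show ?thesis using nth[of n] last by (simp add: joined_def)
    qed
  qed (use snoc.prems len in auto)
  moreover have "connecting G c (rev (z # y # p)) ?es"
    unfolding connecting_def
  proof (intro allI impI)
    fix n assume n: "0 < n \<and> n < length ?es"
    then consider "n < length es" | "n = length es" by fastforce
    then show "if collision (?es ! (n - 1)) (?es ! n)
      then rev (z # y # p) ! n \<in> c \<or> descendants G (rev (z # y # p) ! n) \<inter> c \<noteq> {}
      else rev (z # y # p) ! n \<notin> c"
    proof cases
      case 1
      with es(2) n show ?thesis
        using nth[of n] by (auto simp: connecting_def nth_append[of es])
    next
      case 2
      then have "?es ! (n - 1) = last es" "?es ! n = edge_of m d"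
        using len n by (auto simp: nth_append last_conv_nth)
      with 2 snoc.hyps(2) show ?thesis
        using nth[of n] last es(3) by (auto simp: passable_def collision_iff act_def split: if_splits)
    qed
  qed
  ultimately show ?case by (intro exI[of _ ?es]) auto
qed

section \<open>Summary graphs\<close>

lemma summary_graph_facts:
  assumes "summary_graph u v G"
  shows "symmetric (joined G)"
    and "joined G i a k b \<Longrightarrow> i \<in> nodes G \<and> k \<in> nodes G \<and> i \<noteq> k"
    and "joined G i True k b \<Longrightarrow> i \<in> u"
    and "i \<in> u \<Longrightarrow> joined G i False k b \<Longrightarrow> b \<and> (i, k) \<in> arrows G"
    and "(i, k) \<in> (arrows G)\<^sup>+ \<Longrightarrow> k \<in> u"
    and "(i, i) \<notin> (arrows G)\<^sup>+"
proof -
  note G = assms[unfolded summary_graph_def]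
  show "symmetric (joined G)" using G by (simp add: symmetric_joined_iff)
  have arrow: "k \<in> u" if "(i, k) \<in> arrows G" for i k using G that by blast
  have trancl: "k \<in> u" if "(i, k) \<in> (arrows G)\<^sup>+" for i k
    using that by cases (auto dest: arrow)
  \<comment> \<open>Every arrow ends in \<open>u\<close>, so a directed path from a node of
    \<open>u\<close> stays in \<open>u\<close>, and acyclicity within \<open>u\<close> is acyclicity
    of all arrows.\<close>
  have inner: "(i, k) \<in> (arrows G \<inter> u \<times> u)\<^sup>+" if "(i, k) \<in> (arrows G)\<^sup>+" "i \<in> u" for i k
    using that
  proof (induction)
    case (base k)
    then show ?case by (auto dest: arrow)
  next
    case (step y z)
    then have "(y, z) \<in> arrows G \<inter> u \<times> u" using trancl arrow by blast
    with step show ?case by (meson trancl_into_trancl)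
  qed
  show acyc: "(i, i) \<notin> (arrows G)\<^sup>+" for i
    using inner[of i i] trancl[of i i] G by (auto simp: acyclic_def)
  have "i \<noteq> k" if "(i, k) \<in> arrows G" for i k using acyc that by blast
  then show "joined G i a k b \<Longrightarrow> i \<in> nodes G \<and> k \<in> nodes G \<and> i \<noteq> k"
    using G by (cases a; cases b) (auto simp: joined_simps irrefl_def)
  show "joined G i True k b \<Longrightarrow> i \<in> u"
    using G by (cases b) (auto simp: joined_simps)
  show "i \<in> u \<Longrightarrow> joined G i False k b \<Longrightarrow> b \<and> (i, k) \<in> arrows G"
    using G by (cases b) (auto simp: joined_simps)
  show "(i, k) \<in> (arrows G)\<^sup>+ \<Longrightarrow> k \<in> u" by (fact trancl)
qed

lemma act_arrow: "(i, k) \<in> (arrows G)\<^sup>* \<Longrightarrow> k \<in> act G c \<Longrightarrow> i \<in> act G c"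
  unfolding act_iff by (meson rtrancl_trans)

text \<open>A tail at a node of \<open>u\<close> belongs to an outgoing arrow. So the walk follows
  arrows until its first collision, which is a descendant of \<open>x\<close> in
  \<open>act G c\<close> and puts \<open>x\<close> there too; without a collision the whole walk is
  directed.\<close>

lemma open_walk_tail_start:
  assumes "summary_graph u v G" "open_walk (joined G) (act G c) c x False y b" "x \<in> u"
  shows "x \<in> act G c \<or> b \<and> (x, y) \<in> (arrows G)\<^sup>+"
  using assms(2)
proof (induction)
  case (edge y b)
  then show ?case using summary_graph_facts(4)[OF assms(1,3)] by blast
next
  case (snoc y b m z d)
  show ?case
  proof (cases "x \<in> act G c")
    case False
    with snoc.IH have b: "b" "(x, y) \<in> (arrows G)\<^sup>+" by auto
    with False act_arrow have "y \<notin> act G c" by (metis trancl_into_rtrancl)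
    with snoc.hyps(2) b have "\<not> m" by (auto simp: passable_def)
    with snoc.hyps(3) b summary_graph_facts(4,5)[OF assms(1)] show ?thesis
      by (metis (full_types) trancl.trancl_into_trancl)
  qed simp
qed

text \<open>Cutting out the closed part of a walk at a repeated node \<open>z\<close> can only fail at a new collision
  node \<open>z\<close> that is left and re-entered by tails; but then the closed part, followed along its arrows
  from \<open>z\<close>, has a collision node that is a descendant of \<open>z\<close>.\<close>

lemma open_walk_shorten:
  assumes G: "summary_graph u v G" and "open_walk (joined G) (act G c) c x a y b"
  shows "x = y \<or> (\<exists>p b'. walk_list (joined G) (act G c) c (y # p) b' \<and> last p = x \<and> p \<noteq> [] \<and>
    distinct (y # p) \<and> (\<forall>m. passable (act G c) c b y m \<longrightarrow> passable (act G c) c b' y m))"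
  using assms(2)
proof (induction)
  case (edge y b)
  then show ?case
    using walk_list.edge[of "joined G" x a y b "act G c" c] by (metis distinct_length_2_or_more
      distinct_singleton last_ConsL list.distinct(1))
next
  case (snoc y b m z d)
  have neq: "y \<noteq> z" using summary_graph_facts(2)[OF G snoc.hyps(3)] by simp
  from snoc.IH show ?case
  proof (elim disjE exE conjE)
    assume "x = y"
    then show ?thesis
      using walk_list.edge[of "joined G" y m z d "act G c" c] snoc.hyps(3) neq
      by (intro disjI2 exI[of _ "[y]"] exI[of _ d]) auto
  next
    fix p b'
    assume p: "walk_list (joined G) (act G c) c (y # p) b'" "last p = x" "p \<noteq> []" "distinct (y # p)"
      "\<forall>m. passable (act G c) c b y m \<longrightarrow> passable (act G c) c b' y m"
    \<comment> \<open>The shortened walk may reach \<open>y\<close> with another mark; the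
      quantified clause keeps every continuation open.\<close>
    have pass: "passable (act G c) c b' y m" using p(5) snoc.hyps(2) by blast
    show ?thesis
    proof (cases "z \<in> set p")
      case False
      with walk_list.snoc[OF p(1) pass snoc.hyps(3)] p neq show ?thesis
        by (intro disjI2 exI[of _ "y # p"] exI[of _ d]) auto
    next
      case True
      then obtain q r where qr: "p = q @ z # r" by (auto simp: in_set_conv_decomp)
      show ?thesis
      proof (cases "r = []")
        case True
        with p(2) qr show ?thesis by simp
      next
        case False
        from walk_list_split[OF p(1), of "y # q" z r] qr False obtain m1 m2 where
          w: "walk_list (joined G) (act G c) c (z # r) m1" "passable (act G c) c m1 z m2"
          "open_walk (joined G) (act G c) c z m2 y b'" by auto
        have loop: "open_walk (joined G) (act G c) c z m2 z d"
          using w(3) pass snoc.hyps(3) by (rule open_walk.snoc)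
        \<comment> \<open>If \<open>m2\<close> or \<open>d\<close> is a head, or \<open>m1\<close>
          or \<open>m4\<close> a tail, one of the two old passages through \<open>z\<close> already
          gives the claim. The remaining case is the new collision.\<close>
        have "passable (act G c) c m1 z m4" if m4: "passable (act G c) c d z m4" for m4
        proof (cases "m1 \<and> m4 \<and> \<not> m2 \<and> \<not> d")
          case True
          have "z \<in> u"
            using w(1) True summary_graph_facts(1,3)[OF G]
            by cases (metis symmetricD)+
          with loop True open_walk_tail_start[OF G, of c z z d] show ?thesis
            by (auto simp: passable_def)
        next
          case False
          with m4 w(2) show ?thesis by (auto simp: passable_def split: if_splits)
        qed
        with w(1) p qr False show ?thesis
          by (intro disjI2 exI[of _ r] exI[of _ m1]) auto
      qed
    qed
  qed
qed

text \<open>Disjointness gives \<open>x \<noteq> y\<close>, so shortening an open walk leaves a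
  genuine path.\<close>

lemma implies_indep_iff_open_walk:
  assumes "summary_graph u v G" "\<alpha> \<inter> \<beta> = {}"
  shows "implies_indep G \<alpha> \<beta> c \<longleftrightarrow>
    \<not> (\<exists>x \<in> \<alpha>. \<exists>y \<in> \<beta>. \<exists>a b. open_walk (joined G) (act G c) c x a y b)"
proof -
  have "\<exists>p es. is_path G p es \<and> hd p \<in> \<alpha> \<and> last p \<in> \<beta> \<and> connecting G c p es"
    if xy: "x \<in> \<alpha>" "y \<in> \<beta>" and "open_walk (joined G) (act G c) c x a y b" for x y a b
  proof -
    have "x \<noteq> y" using xy assms(2) by auto
    with open_walk_shorten[OF assms(1) that(3)] obtain p b' where
      p: "walk_list (joined G) (act G c) c (y # p) b'" "last p = x" "p \<noteq> []" "distinct (y # p)"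
      by blast
    from path_of_walk_list[OF p(1,4)] obtain es where
      "is_path G (rev (y # p)) es" "connecting G c (rev (y # p)) es" by auto
    moreover have "hd (rev (y # p)) = x" "last (rev (y # p)) = y"
      using p by (auto simp: hd_append hd_rev)
    ultimately show ?thesis using xy by metis
  qed
  moreover have "\<exists>x \<in> \<alpha>. \<exists>y \<in> \<beta>. \<exists>a b. open_walk (joined G) (act G c) c x a y b"
    if p: "is_path G p es" "hd p \<in> \<alpha>" "last p \<in> \<beta>" "connecting G c p es" for p es
  proof -
    have len: "es \<noteq> []" "length p = Suc (length es)" using p(1) by (auto simp: is_path_def)
    then have "p \<noteq> []" by auto
    with len have "hd p = p ! 0" "last p = p ! Suc (length es - 1)"
      by (simp_all add: hd_conv_nth last_conv_nth)
    moreover have "length es - 1 < length es" using len by simp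
    ultimately show ?thesis using open_walk_of_path[OF p(1,4)] p(2,3) by metis
  qed
  ultimately show ?thesis unfolding implies_indep_def by blast
qed

section \<open>Eliminating inner nodes\<close>

text \<open>Unlike the edge insertions of the procedure, these also produce loops. Walks can then be
  rewritten edge by edge, and the loops are cut out at the end.\<close>

definition bypass_transmitting ::
  "'a \<Rightarrow> ('a \<Rightarrow> bool \<Rightarrow> 'a \<Rightarrow> bool \<Rightarrow> bool) \<Rightarrow> 'a \<Rightarrow> bool \<Rightarrow> 'a \<Rightarrow> bool \<Rightarrow> bool" where
  "bypass_transmitting t R i a k b \<longleftrightarrow> i \<noteq> t \<and> k \<noteq> t \<and>
    (R i a k b \<or> (\<exists>m m'. R i a t m \<and> R t m' k b \<and> \<not> (m \<and> m')))"

definition bypass_collision ::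
  "'a \<Rightarrow> ('a \<Rightarrow> bool \<Rightarrow> 'a \<Rightarrow> bool \<Rightarrow> bool) \<Rightarrow> 'a \<Rightarrow> bool \<Rightarrow> 'a \<Rightarrow> bool \<Rightarrow> bool" where
  "bypass_collision j R i a k b \<longleftrightarrow> R i a k b \<or> R i a j True \<and> R j True k b"

text \<open>The two edges at \<open>t\<close> must be replaced together, so for a walk that has
  arrived at \<open>t\<close> the induction speaks about its continuation by one more edge. An open
  collision at \<open>t\<close> is rerouted through a child \<open>w\<close> in \<open>A\<close>,
  where it is an open collision again.\<close>

lemma open_walk_bypass_transmitting:
  assumes "open_walk R A C x a y b" "x \<noteq> t" "\<And>a b. \<not> R t a t b" "symmetric R"
    and child: "t \<in> A \<Longrightarrow> \<exists>w \<in> A. w \<noteq> t \<and> R t False w True"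
  shows "(y \<noteq> t \<longrightarrow> open_walk (bypass_transmitting t R) A C x a y b) \<and>
    (y = t \<longrightarrow> (\<forall>m k d. passable A C b t m \<longrightarrow> R t m k d \<longrightarrow>
      open_walk (bypass_transmitting t R) A C x a k d))"
proof -
  have through: "R i a k b \<Longrightarrow> i \<noteq> t \<Longrightarrow> k \<noteq> t \<Longrightarrow> bypass_transmitting t R i a k b"
    and via: "R i a t m \<Longrightarrow> R t m' k b \<Longrightarrow> \<not> (m \<and> m') \<Longrightarrow> bypass_transmitting t R i a k b"
    for i a k b m m'
    using assms(3) unfolding bypass_transmitting_def by blast+
  have two: "bypass_transmitting t R i a k d \<or> (\<exists>w \<in> A. bypass_transmitting t R i a w True \<and>
      bypass_transmitting t R w True k d)"
    if "R i a t b" "R t m k d" "passable A C b t m" for i a b m k d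
  proof (cases "b \<and> m")
    case True
    with that child obtain w where w: "w \<in> A" "R t False w True" by (auto simp: passable_def)
    then have "R w True t False" using assms(4) by (blast dest: symmetricD)
    with w that show ?thesis by (blast intro: via)
  next
    case False
    with that show ?thesis by (blast intro: via)
  qed
  let ?W = "open_walk (bypass_transmitting t R) A C x a"
  show ?thesis
    using assms(1)
  proof (induction)
    case (edge y b)
    have "?W k d" if "y = t" "passable A C b t m" "R t m k d" for m k d
      using two[OF edge[unfolded that(1)] that(3,2)]
    proof (elim disjE bexE conjE)
      fix w assume w: "w \<in> A" "bypass_transmitting t R x a w True"
        "bypass_transmitting t R w True k d"
      have "passable A C True w True" using w(1) by (simp add: passable_def)
      from open_walk.snoc[OF open_walk.edge this, of "bypass_transmitting t R", OF w(2,3)]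
      show ?thesis .
    qed (rule open_walk.edge)
    moreover have "?W y b" if "y \<noteq> t"
      using through[OF edge assms(2) that] by (rule open_walk.edge)
    ultimately show ?case by blast
  next
    case (snoc y b m z d)
    show ?case
    proof (cases "y = t")
      case True
      then have "z \<noteq> t" using snoc.hyps(3) assms(3) by blast
      with True snoc.IH snoc.hyps(2,3) show ?thesis by blast
    next
      case False
      with snoc.IH have y: "?W y b" by blast
      have "?W k e" if t: "z = t" "passable A C d t m'" "R t m' k e" for m' k e
        using two[OF snoc.hyps(3)[unfolded t(1)] t(3,2)]
      proof (elim disjE bexE conjE)
        fix w assume w: "w \<in> A" "bypass_transmitting t R y m w True"
          "bypass_transmitting t R w True k e"
        have "passable A C True w True" using w(1) by (simp add: passable_def)
        from open_walk.snoc[OF open_walk.snoc[OF y snoc.hyps(2) w(2)] this w(3)]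
        show ?thesis .
      qed (rule open_walk.snoc[OF y snoc.hyps(2)])
      moreover have "?W z d" if "z \<noteq> t"
        using open_walk.snoc[OF y snoc.hyps(2) through[OF snoc.hyps(3) False that]] .
      ultimately show ?thesis using False by blast
    qed
  qed
qed

text \<open>For a walk arriving at \<open>j\<close> with a head, the second conjunct already absorbs
  the next edge of a collision. Thus \<open>j\<close> can leave \<open>A\<close>, even if loops
  cause several collisions at \<open>j\<close> in a row.\<close>

lemma open_walk_bypass_collision:
  assumes "open_walk R A C x a y b"
  shows "open_walk (bypass_collision j R) (A - {j}) C x a y b \<and>
    (y = j \<and> b \<longrightarrow> (\<forall>k d. R j True k d \<longrightarrow> open_walk (bypass_collision j R) (A - {j}) C x a k d))"
  using assms
proof (induction)
  case (edge y b)
  then show ?case by (auto intro!: open_walk.edge simp: bypass_collision_def)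
next
  case (snoc y b m z d)
  show ?case
  proof (cases "y = j \<and> b \<and> m")
    case True
    with snoc show ?thesis by auto
  next
    case False
    with snoc.hyps(2) have p: "passable (A - {j}) C b y m" by (auto simp: passable_def)
    have "bypass_collision j R y m z d"
      "z = j \<and> d \<Longrightarrow> R j True k e \<Longrightarrow> bypass_collision j R y m k e" for k e
      using snoc.hyps(3) by (auto simp: bypass_collision_def)
    with snoc.IH p show ?thesis by (blast intro: open_walk.snoc)
  qed
qed

text \<open>\<open>A\<close> only shrinks, so treating a later node brings back no collision at an
  earlier one, and any order of \<open>js\<close> works.\<close>

lemma open_walk_bypass_collisions:
  "open_walk R A C x a y b \<Longrightarrow>
    open_walk (fold bypass_collision js R) (A - set js) C x a y b"
proof (induction js arbitrary: R A)
  case (Cons j js)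
  have "open_walk (bypass_collision j R) (A - {j}) C x a y b"
    using open_walk_bypass_collision[OF Cons.prems] by blast
  from Cons.IH[OF this] show ?case by (simp add: set_diff_eq Diff_insert2 Diff_insert)
qed simp

lemma joined_delete_reorient:
  assumes "U \<inter> V = {}"
  shows "joined (delete_nodes X (reorient U V H)) i a k b \<longleftrightarrow> i \<notin> X \<and> k \<notin> X \<and>
    (if i \<in> V \<and> k \<in> V then \<not> a \<and> \<not> b \<and> neighbours H i k
     else if i \<in> V \<and> k \<in> U then \<not> a \<and> b \<and> neighbours H i k
     else if i \<in> U \<and> k \<in> V then a \<and> \<not> b \<and> neighbours H k i
     else joined H i a k b)"
  using assms
  by (cases a; cases b) (auto simp: joined_simps delete_nodes_def reorient_def Let_def)

section \<open>Marginalising over one node and conditioning on another\<close>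

locale marginalise_condition =
  fixes G :: "'a mgraph" and u v :: "'a set" and s t :: 'a and js :: "'a list"
  assumes summary: "summary_graph u v G"
    and s_neq_t: "s \<noteq> t"
    and set_js: "set js = {j. j \<noteq> t \<and> (j = s \<or> j \<in> ancestors G s)}"
begin

definition V where "V = (v \<union> (ancestors G s \<inter> u)) - {s, t}"
definition U where "U = nodes G - {s, t} - V"
definition H where "H = close_edges t js G"
definition G' where "G' = delete_nodes {s, t} (reorient U V H)"
text \<open>The same eliminations as in \<open>H\<close>, but with loops; it mediates between the
  walks of \<open>G\<close> and those of \<open>G'\<close>.\<close>

definition closure where
  "closure = fold bypass_collision js (bypass_transmitting t (joined G))"

lemmas summary_facts = summary_graph_facts[OF summary]

lemma set_js_iff: "j \<in> set js \<longleftrightarrow> j \<noteq> t \<and> (j, s) \<in> (arrows G)\<^sup>*"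
  unfolding set_js ancestors_def by (auto simp: rtrancl_eq_or_trancl)

lemma nodes_G: "nodes G = u \<union> v" "u \<inter> v = {}"
  using summary unfolding summary_graph_def by auto

lemma U_iff: "i \<in> U \<longleftrightarrow> i \<in> u \<and> i \<noteq> t \<and> (i, s) \<notin> (arrows G)\<^sup>*"
  unfolding U_def V_def ancestors_def using nodes_G by (auto simp: rtrancl_eq_or_trancl)

lemma U_V: "U \<union> V = nodes G - {s, t}" "U \<inter> V = {}"
  unfolding U_def V_def using nodes_G by auto

lemma V_u: "i \<in> V \<Longrightarrow> i \<in> u \<Longrightarrow> i \<in> set js"
  using nodes_G unfolding V_def set_js by auto

lemma U_js: "i \<in> U \<Longrightarrow> i \<notin> set js"
  by (simp add: U_iff set_js_iff)

text \<open>Invariant of the eliminations. The clause on tails outside \<open>js\<close> will give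
  acyclicity and the orientation towards \<open>U\<close>. The last clause expands an edge into a
  walk of \<open>G\<close>; conditioning on \<open>s\<close> is what will ensure
  \<open>set js \<subseteq> A\<close>.\<close>

definition sound_edges where
  "sound_edges R \<longleftrightarrow> symmetric R \<and> (\<forall>i a k b. R i a k b \<longrightarrow>
    i \<in> nodes G - {t} \<and> (a \<longrightarrow> i \<in> u) \<and>
    (i \<in> u \<and> i \<notin> set js \<and> \<not> a \<longrightarrow> b \<and> (i, k) \<in> (arrows G)\<^sup>+) \<and>
    (\<forall>A C. set js \<subseteq> A \<and> t \<notin> C \<longrightarrow> open_walk (joined G) A C i a k b))"

lemma sound_edges_transmitting: "sound_edges (bypass_transmitting t (joined G))"
proof -
  have "symmetric (bypass_transmitting t (joined G))"
    using symmetricD[OF summary_facts(1)] unfolding symmetric_def bypass_transmitting_def by blast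
  moreover have "i \<in> nodes G - {t} \<and> (a \<longrightarrow> i \<in> u) \<and>
    (i \<in> u \<and> i \<notin> set js \<and> \<not> a \<longrightarrow> b \<and> (i, k) \<in> (arrows G)\<^sup>+) \<and>
    (\<forall>A C. set js \<subseteq> A \<and> t \<notin> C \<longrightarrow> open_walk (joined G) A C i a k b)"
    if R: "bypass_transmitting t (joined G) i a k b" for i a k b
  proof (cases "joined G i a k b")
    case True
    with R show ?thesis
      using summary_facts(2)[OF True] summary_facts(3)[of i k b] summary_facts(4)[of i k b]
      by (cases a) (auto intro: open_walk.edge simp: bypass_transmitting_def)
  next
    case False
    with R obtain m m' where m: "i \<noteq> t" "joined G i a t m" "joined G t m' k b" "\<not> (m \<and> m')"
      unfolding bypass_transmitting_def by blast
    have "b \<and> (i, k) \<in> (arrows G)\<^sup>+" if "i \<in> u" "\<not> a"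
    proof -
      \<comment> \<open>The tail at \<open>i\<close> means \<open>i \<rightarrow> t\<close>, so
        \<open>t\<close> lies in \<open>u\<close>; as it transmits, it is left by a tail, that is,
        by an arrow to \<open>k\<close>.\<close>
      have "m" "(i, t) \<in> arrows G" using summary_facts(4)[of i t m] m that by auto
      moreover from this have "t \<in> u" using summary_facts(5) by blast
      ultimately show ?thesis using summary_facts(4)[of t k b] m by (auto intro: trancl_into_trancl)
    qed
    moreover have "open_walk (joined G) A C i a k b" if "t \<notin> C" for A C
      using m that
      by (intro open_walk.snoc[OF open_walk.edge, of _ i a t m _ _ m']) (auto simp: passable_def)
    ultimately show ?thesis
      using summary_facts(2)[OF m(2)] summary_facts(3)[of i t m] m by (cases a) auto
  qed
  ultimately show ?thesis unfolding sound_edges_def by blast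
qed

lemma sound_edges_collision:
  assumes R: "sound_edges R" and j: "j \<in> set js"
  shows "sound_edges (bypass_collision j R)"
proof -
  note sound = R[unfolded sound_edges_def, THEN conjunct2, rule_format]
  have "symmetric R" using R unfolding sound_edges_def by blast
  then have "symmetric (bypass_collision j R)"
    using symmetricD[of R] unfolding symmetric_def bypass_collision_def by blast
  moreover have "i \<in> nodes G - {t} \<and> (a \<longrightarrow> i \<in> u) \<and>
    (i \<in> u \<and> i \<notin> set js \<and> \<not> a \<longrightarrow> b \<and> (i, k) \<in> (arrows G)\<^sup>+) \<and>
    (\<forall>A C. set js \<subseteq> A \<and> t \<notin> C \<longrightarrow> open_walk (joined G) A C i a k b)"
    if "bypass_collision j R i a k b" for i a k b
  proof (cases "R i a k b")
    case True
    then show ?thesis by (rule sound)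
  next
    case False
    with that have j2: "R i a j True" "R j True k b" unfolding bypass_collision_def by auto
    \<comment> \<open>Outside \<open>js\<close>, a tail at \<open>i\<close> would make
      \<open>i\<close> an ancestor of \<open>j\<close> and so of \<open>s\<close>, which is absurd;
      the clause on tails is vacuous for the new edge.\<close>
    have "i \<in> set js" if "i \<in> u" "\<not> a"
    proof (rule ccontr)
      assume i: "i \<notin> set js"
      with sound[OF j2(1)] that have "(i, j) \<in> (arrows G)\<^sup>+" "i \<noteq> t" by auto
      with j i show False unfolding set_js_iff by (meson trancl_into_rtrancl rtrancl_trans)
    qed
    moreover have "open_walk (joined G) A C i a k b" if "set js \<subseteq> A" "t \<notin> C" for A C
      using sound[OF j2(1)] sound[OF j2(2)] that j
      by (intro open_walk_append[of _ _ _ j True k b i a True]) (auto simp: passable_def)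
    ultimately show ?thesis using sound[OF j2(1)] by blast
  qed
  ultimately show ?thesis unfolding sound_edges_def by blast
qed

lemma sound_edges_closure: "sound_edges closure"
  unfolding closure_def
  by (rule fold_invariant[where P = sound_edges and Q = "\<lambda>j. j \<in> set js"])
    (auto intro: sound_edges_transmitting sound_edges_collision)

lemma closure_facts:
  shows closure_sym: "closure i a k b \<Longrightarrow> closure k b i a"
    and closure_node: "closure i a k b \<Longrightarrow> i \<in> nodes G - {t} \<and> k \<in> nodes G - {t}"
    and closure_head: "closure i a k b \<Longrightarrow> a \<Longrightarrow> i \<in> u"
    and closure_tail: "closure i a k b \<Longrightarrow> \<not> a \<Longrightarrow> i \<in> U \<Longrightarrow> b \<and> (i, k) \<in> (arrows G)\<^sup>+"
    and closure_walk: "closure i a k b \<Longrightarrow> set js \<subseteq> A \<Longrightarrow> t \<notin> C \<Longrightarrow> open_walk (joined G) A C i a k b"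
proof -
  note sound = sound_edges_closure[unfolded sound_edges_def, THEN conjunct2, rule_format]
  show sym: "closure i a k b \<Longrightarrow> closure k b i a" for i a k b
    using sound_edges_closure unfolding sound_edges_def by (blast dest: symmetricD)
  show "closure i a k b \<Longrightarrow> i \<in> nodes G - {t} \<and> k \<in> nodes G - {t}"
    using sound sym by blast
  show "closure i a k b \<Longrightarrow> a \<Longrightarrow> i \<in> u"
    using sound by blast
  show "closure i a k b \<Longrightarrow> \<not> a \<Longrightarrow> i \<in> U \<Longrightarrow> b \<and> (i, k) \<in> (arrows G)\<^sup>+"
    using sound[of i a k b] U_js[of i] U_iff[of i] by blast
  show "closure i a k b \<Longrightarrow> set js \<subseteq> A \<Longrightarrow> t \<notin> C \<Longrightarrow> open_walk (joined G) A C i a k b"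
    using sound by blast
qed

section \<open>The edges inserted by the procedure compared with the closure\<close>

text \<open>Passing through a loop at an eliminated node can turn a head into a tail, so the closure may
  have edges that the procedure does not insert. The procedure then inserts the same edge with a head
  in place of the tail. This is harmless, because eliminated nodes end up in \<open>V\<close> or are deleted.\<close>

definition covers :: "'a \<Rightarrow> bool \<Rightarrow> bool \<Rightarrow> bool" where
  "covers i a' a \<longleftrightarrow> (a \<longrightarrow> a') \<and> (i \<notin> set js \<longrightarrow> a' = a)"

text \<open>\<open>K\<close> may still have edges at \<open>t\<close>, so only its edges off
  \<open>t\<close> are compared; loops of \<open>R\<close> have no counterpart in
  \<open>K\<close>.\<close>

definition matches where
  "matches K R \<longleftrightarrow> symmetric (joined K) \<and>
    (\<forall>i a k b. joined K i a k b \<longrightarrow> i \<noteq> t \<longrightarrow> k \<noteq> t \<longrightarrow> i \<noteq> k \<and> R i a k b) \<and>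
    (\<forall>i a k b. R i a k b \<longrightarrow> i \<noteq> t \<and> k \<noteq> t) \<and>
    (\<forall>i a k b. R i a k b \<longrightarrow> i \<noteq> k \<longrightarrow>
      (\<exists>a' b'. joined K i a' k b' \<and> covers i a' a \<and> covers k b' b))"

lemma matches_transmitting:
  "matches (insert_induced marginalising {} t G) (bypass_transmitting t (joined G))"
  unfolding matches_def
proof (intro conjI allI impI)
  note ins = joined_insert_marginalising[OF summary_facts(1), of "{}" t]
  show "symmetric (joined (insert_induced marginalising {} t G))"
    by (rule symmetric_insert_marginalising[OF summary_facts(1)])
  fix i k a b
  show "i \<noteq> k" if "joined (insert_induced marginalising {} t G) i a k b"
    using that summary_facts(2) unfolding ins by blast
  show "bypass_transmitting t (joined G) i a k b"
    if "joined (insert_induced marginalising {} t G) i a k b" "i \<noteq> t" "k \<noteq> t"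
    using that unfolding ins bypass_transmitting_def by blast
  assume "bypass_transmitting t (joined G) i a k b" "i \<noteq> k"
  then have "joined (insert_induced marginalising {} t G) i a k b"
    unfolding ins bypass_transmitting_def by blast
  moreover have "covers i a a" "covers k b b" unfolding covers_def by simp_all
  ultimately show "\<exists>a' b'. joined (insert_induced marginalising {} t G) i a' k b' \<and>
    covers i a' a \<and> covers k b' b" by blast
qed (auto simp: bypass_transmitting_def)

lemma matches_collision:
  assumes M: "matches K R" and j: "j \<in> set js"
  shows "matches (insert_induced conditioning {t} j K) (bypass_collision j R)"
proof -
  have sym: "symmetric (joined K)" using M unfolding matches_def by (elim conjE)
  have to: "i \<noteq> k \<and> R i a k b" if "joined K i a k b" "i \<noteq> t" "k \<noteq> t" for i a k b
    using M that unfolding matches_def by simp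
  have from_t: "i \<noteq> t \<and> k \<noteq> t" if "R i a k b" for i a k b
    using M that unfolding matches_def by blast
  have fro: "\<exists>a' b'. joined K i a' k b' \<and> covers i a' a \<and> covers k b' b"
    if "R i a k b" "i \<noteq> k" for i a k b
    using M that unfolding matches_def by simp
  have jt: "j \<noteq> t" using j by (simp add: set_js_iff)
  have cov: "covers j True a" for a using j by (simp add: covers_def)
  note ins = joined_insert_conditioning[OF sym, of "{t}" j]
  show ?thesis
    unfolding matches_def
  proof (intro conjI allI impI)
    show "symmetric (joined (insert_induced conditioning {t} j K))"
      by (rule symmetric_insert_conditioning[OF sym])
    fix i k a b
    show "i \<noteq> k" if "joined (insert_induced conditioning {t} j K) i a k b" "i \<noteq> t" "k \<noteq> t"
      using that to[of i a k b] unfolding ins by blast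
    show "bypass_collision j R i a k b"
      if "joined (insert_induced conditioning {t} j K) i a k b" "i \<noteq> t" "k \<noteq> t"
      using that to[of i a k b] to[of i a j True] to[of j True k b] jt
      unfolding ins bypass_collision_def by blast
    show "i \<noteq> t" "k \<noteq> t" if "bypass_collision j R i a k b"
      using that from_t unfolding bypass_collision_def by blast+
    assume R: "bypass_collision j R i a k b" "i \<noteq> k"
    then consider "R i a k b" | "R i a j True" "R j True k b" "i = j" |
      "R i a j True" "R j True k b" "k = j" |
      "R i a j True" "R j True k b" "i \<noteq> j" "k \<noteq> j"
      unfolding bypass_collision_def by argo
    then show "\<exists>a' b'. joined (insert_induced conditioning {t} j K) i a' k b' \<and>
      covers i a' a \<and> covers k b' b"
    proof cases
      case 1
      from fro[OF 1 R(2)] show ?thesis unfolding ins by blast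
    next
      case 2
      \<comment> \<open>The first edge is a loop at \<open>j\<close>, so nothing new is needed: the
        edge of \<open>K\<close> from \<open>j\<close> to \<open>k\<close> has a head at
        \<open>j\<close>, which covers any mark there.\<close>
      then obtain a' b' where "joined K j a' k b'" "covers j a' True" "covers k b' b"
        using fro R(2) by blast
      moreover from this(2) have "a'" by (simp add: covers_def)
      ultimately show ?thesis using 2 cov[of a] unfolding ins by (metis (full_types))
    next
      case 3
      then obtain a' b' where "joined K i a' j b'" "covers j b' True" "covers i a' a"
        using fro R(2) by blast
      moreover from this(2) have "b'" by (simp add: covers_def)
      ultimately show ?thesis using 3 cov[of b] unfolding ins by (metis (full_types))
    next
      case 4
      obtain a' m where i: "joined K i a' j m" "covers i a' a" "covers j m True"
        using fro[OF 4(1,3)] by blast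
      obtain m' b' where k: "joined K j m' k b'" "covers k b' b" "covers j m' True"
        using fro[OF 4(2)] 4(4) by blast
      \<comment> \<open>Covering keeps heads, so the two edges of \<open>K\<close> collide at
        \<open>j\<close> too and the conditioning rule applies.\<close>
      have "m" "m'" using i(3) k(3) by (simp_all add: covers_def)
      then have "joined (insert_induced conditioning {t} j K) i a' k b'"
        using i(1) k(1) from_t[OF 4(1)] from_t[OF 4(2)] R(2) unfolding ins by simp
      with i(2) k(2) show ?thesis by blast
    qed
  qed
qed

lemma matches_closure: "matches H closure"
proof -
  have "matches (fold (insert_induced conditioning {t}) xs K) (fold bypass_collision xs R)"
    if "matches K R" "set xs \<subseteq> set js" for xs K R
    using that by (induction xs arbitrary: K R) (auto intro: matches_collision)
  from this[OF matches_transmitting, of js] show ?thesis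
    unfolding H_def close_edges_def closure_def by simp
qed

lemma H_facts:
  shows H_sym: "symmetric (joined H)"
    and H_closure: "joined H i a k b \<Longrightarrow> i \<noteq> t \<Longrightarrow> k \<noteq> t \<Longrightarrow> i \<noteq> k \<and> closure i a k b"
    and closure_H: "closure i a k b \<Longrightarrow> i \<noteq> k \<Longrightarrow> \<exists>a' b'. joined H i a' k b' \<and>
        (i \<in> U \<longrightarrow> a' = a) \<and> (k \<in> U \<longrightarrow> b' = b)"
proof -
  show "symmetric (joined H)" using matches_closure unfolding matches_def by (elim conjE)
  show "i \<noteq> k \<and> closure i a k b" if "joined H i a k b" "i \<noteq> t" "k \<noteq> t"
    using matches_closure that unfolding matches_def by simp
  assume "closure i a k b" "i \<noteq> k"
  then obtain a' b' where "joined H i a' k b'" "covers i a' a" "covers k b' b"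
    using matches_closure unfolding matches_def by metis
  then show "\<exists>a' b'. joined H i a' k b' \<and> (i \<in> U \<longrightarrow> a' = a) \<and> (k \<in> U \<longrightarrow> b' = b)"
    unfolding covers_def using U_js by blast
qed

lemma neighbours_H_sym: "neighbours H i k \<Longrightarrow> neighbours H k i"
  using H_sym unfolding neighbours_iff_joined by (blast dest: symmetricD)

section \<open>The edges of \<open>G'\<close> and its being a summary graph\<close>

lemmas joined_G' = joined_delete_reorient[OF U_V(2), of "{s, t}" H, folded G'_def]

text \<open>A tail at \<open>i\<close> would give a directed path to \<open>k\<close>, so
  \<open>k\<close> would lie in \<open>u\<close> and be an ancestor of \<open>s\<close>, and so
  would \<open>i\<close>. Hence turning the edge into an arrow towards \<open>U\<close> keeps the
  mark at its \<open>U\<close> end.\<close>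

lemma closure_U_V:
  assumes "closure i a k b" "i \<in> U" "k \<in> V"
  shows "a"
proof (rule ccontr)
  assume "\<not> a"
  with assms(2) closure_tail[OF assms(1)] have ik: "(i, k) \<in> (arrows G)\<^sup>+" by simp
  then have "k \<in> u" by (rule summary_facts(5))
  with assms(3) have "(k, s) \<in> (arrows G)\<^sup>*" using V_u set_js_iff by blast
  with ik have "(i, s) \<in> (arrows G)\<^sup>*" by (meson trancl_into_rtrancl rtrancl_trans)
  with assms(2) show False by (simp add: U_iff)
qed

text \<open>Reorientation alters marks only at nodes of \<open>V\<close>, so an edge of
  \<open>G'\<close> and its source in \<open>closure\<close> agree at ends in \<open>U\<close>. This
  is what the transfer of walks relies on.\<close>

lemma G'_edge:
  assumes "joined G' i a k b"
  shows "i \<in> U \<union> V" "k \<in> U \<union> V" "i \<noteq> k" "i \<in> V \<Longrightarrow> \<not> a" "k \<in> V \<Longrightarrow> \<not> b"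
    and "\<exists>a' b'. closure i a' k b' \<and> (i \<in> U \<longrightarrow> a' = a) \<and> (k \<in> U \<longrightarrow> b' = b)"
proof -
  have "neighbours H i k" "i \<notin> {s, t}" "k \<notin> {s, t}"
    using assms neighbours_H_sym unfolding joined_G'
    by (auto split: if_splits simp: neighbours_iff_joined)
  then obtain a0 b0 where ab: "closure i a0 k b0" "i \<noteq> k"
    unfolding neighbours_iff_joined using H_closure by blast
  with closure_node[OF ab(1)] \<open>i \<notin> {s, t}\<close> \<open>k \<notin> {s, t}\<close>
  show nodes: "i \<in> U \<union> V" "k \<in> U \<union> V" "i \<noteq> k" unfolding U_V by auto
  show "i \<in> V \<Longrightarrow> \<not> a" "k \<in> V \<Longrightarrow> \<not> b"
    using assms nodes U_V(2) unfolding joined_G' by (auto split: if_splits)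
  show "\<exists>a' b'. closure i a' k b' \<and> (i \<in> U \<longrightarrow> a' = a) \<and> (k \<in> U \<longrightarrow> b' = b)"
  proof (cases "i \<in> U \<and> k \<in> U")
    case True
    then have "i \<notin> V" "k \<notin> V" using U_V(2) by auto
    with assms have "joined H i a k b" unfolding joined_G' by (auto split: if_splits)
    with H_closure \<open>i \<notin> {s, t}\<close> \<open>k \<notin> {s, t}\<close> show ?thesis by blast
  next
    case False
    have "i \<in> U \<Longrightarrow> k \<in> V \<Longrightarrow> a \<and> a0" "i \<in> V \<Longrightarrow> k \<in> U \<Longrightarrow> b \<and> b0"
      using assms U_V(2) closure_U_V[OF ab(1)] closure_U_V[OF closure_sym[OF ab(1)]]
      unfolding joined_G' by (auto split: if_splits)
    with ab False nodes U_V(2) show ?thesis by blast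
  qed
qed

lemma closure_G':
  assumes "closure i a k b" "i \<noteq> k" "i \<in> U \<union> V" "k \<in> U \<union> V"
  shows "\<exists>a' b'. joined G' i a' k b' \<and> (i \<in> U \<longrightarrow> a' = a) \<and> (k \<in> U \<longrightarrow> b' = b)"
proof -
  obtain a0 b0 where ab: "joined H i a0 k b0" "i \<in> U \<longrightarrow> a0 = a" "k \<in> U \<longrightarrow> b0 = b"
    using closure_H[OF assms(1,2)] by blast
  then have nb: "neighbours H i k" "neighbours H k i"
    using neighbours_H_sym unfolding neighbours_iff_joined by blast+
  have st: "i \<notin> {s, t}" "k \<notin> {s, t}" using assms(3,4) unfolding U_V by auto
  show ?thesis
  proof (cases "i \<in> V \<or> k \<in> V")
    case True
    with assms closure_U_V[OF assms(1)] closure_U_V[OF closure_sym[OF assms(1)]] nb st U_V(2)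
    have "joined G' i (i \<in> U) k (k \<in> U)" "i \<in> U \<longrightarrow> a" "k \<in> U \<longrightarrow> b"
      unfolding joined_G' by auto
    then show ?thesis by blast
  next
    case False
    with ab st have "joined G' i a0 k b0" unfolding joined_G' by auto
    with ab show ?thesis by blast
  qed
qed

lemma nodes_G': "nodes G' = U \<union> V"
proof -
  have "nodes (fold (insert_induced conditioning X) xs K) = nodes K" for X xs and K :: "'a mgraph"
    by (induction xs arbitrary: K) (simp_all add: insert_induced_def)
  then have "nodes H = nodes G" unfolding H_def close_edges_def by (simp add: insert_induced_def)
  then show ?thesis unfolding U_V G'_def by (simp add: delete_nodes_def reorient_def Let_def)
qed

text \<open>A tail in \<open>U\<close> stems from a directed path of \<open>G\<close>, and
  \<open>closure_U_V\<close> excludes an end in \<open>V\<close>. This gives acyclicity of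
  \<open>G'\<close> and brings its descendants back to \<open>G\<close>.\<close>

lemma G'_tail:
  assumes "joined G' i False k b" "i \<in> U"
  shows "b" "k \<in> U" "(i, k) \<in> (arrows G)\<^sup>+"
proof -
  obtain b' where b': "closure i False k b'" "k \<in> U \<longrightarrow> b' = b"
    using G'_edge(6)[OF assms(1)] assms(2) by auto
  then show k: "k \<in> U" "(i, k) \<in> (arrows G)\<^sup>+"
    using closure_tail[OF _ _ assms(2)] closure_U_V[OF _ assms(2)] G'_edge(2)[OF assms(1)] by blast+
  with b' closure_tail[OF _ _ assms(2)] show "b" by blast
qed

lemma summary_graph_G': "summary_graph U V G'"
proof -
  have sym: "symmetric (joined G')"
    unfolding symmetric_def
  proof (intro allI impI)
    fix i a k b assume *: "joined G' i a k b"
    have "joined H i a k b \<Longrightarrow> joined H k b i a" by (rule symmetricD[OF H_sym])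
    moreover have "neighbours H i k \<longleftrightarrow> neighbours H k i" using neighbours_H_sym by blast
    moreover have "i \<in> V \<Longrightarrow> i \<notin> U" "k \<in> V \<Longrightarrow> k \<notin> U" using U_V(2) by auto
    ultimately show "joined G' k b i a"
      using * unfolding joined_G' by argo
  qed
  have "finite (nodes G')"
    using summary unfolding nodes_G' U_V summary_graph_def by blast
  moreover have "arrows G' \<subseteq> U \<times> U \<union> V \<times> U"
  proof (rule subrelI)
    fix i k assume "(i, k) \<in> arrows G'"
    then show "(i, k) \<in> U \<times> U \<union> V \<times> U"
      using G'_edge(1,2,5)[of i False k True, unfolded joined_simps] by blast
  qed
  moreover have "acyclic (arrows G' \<inter> U \<times> U)"
  proof (rule acyclic_subset)
    show "acyclic ((arrows G)\<^sup>+)"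
      using summary_facts(6) by (simp add: acyclic_def)
    show "arrows G' \<inter> U \<times> U \<subseteq> (arrows G)\<^sup>+"
      using G'_tail(3)[of _ _ True, unfolded joined_simps] by blast
  qed
  moreover have "dashes G' \<subseteq> U \<times> U"
  proof (rule subrelI)
    fix i k assume "(i, k) \<in> dashes G'"
    then show "(i, k) \<in> U \<times> U"
      using G'_edge(1,2,4,5)[of i True k True, unfolded joined_simps] by blast
  qed
  moreover have "lines G' \<subseteq> V \<times> V"
  proof (rule subrelI)
    fix i k assume ik: "(i, k) \<in> lines G'"
    then have "joined G' i False k False" by (simp add: joined_simps)
    moreover from this have "joined G' k False i False" by (rule symmetricD[OF sym])
    \<comment> \<open>A tail in \<open>U\<close> forces a head at the other end, so neither end of a
      full line lies in \<open>U\<close>.\<close>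
    ultimately show "(i, k) \<in> V \<times> V"
      using G'_tail(1)[of i k False] G'_tail(1)[of k i False] G'_edge(1,2)[of i False k False] by blast
  qed
  moreover have "irrefl (dashes G')" "irrefl (lines G')"
    using G'_edge(3)[of i True i True for i] G'_edge(3)[of i False i False for i]
    by (auto simp: joined_simps irrefl_def)
  moreover have "sym (dashes G')" "sym (lines G')" using sym by (simp_all add: symmetric_joined_iff)
  ultimately show ?thesis unfolding summary_graph_def using nodes_G' U_V(2) by (intro conjI)
qed

section \<open>Descendants in \<open>G'\<close> and in \<open>G\<close>\<close>

lemma reach_G:
  assumes "(y, z) \<in> (arrows G')\<^sup>*" "y \<in> U"
  shows "z \<in> U \<and> (y, z) \<in> (arrows G)\<^sup>*"
  using assms
proof (induction)
  case (step w z)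
  then have "joined G' w False z True" "w \<in> U" by (auto simp: joined_simps)
  from G'_tail[OF this] step show ?case by (meson trancl_into_rtrancl rtrancl_trans)
qed simp

lemma bypass_transmitting_closure:
  assumes "bypass_transmitting t (joined G) i a k b"
  shows "closure i a k b"
proof -
  have "R i a k b \<Longrightarrow> fold bypass_collision xs R i a k b" for R xs
    by (induction xs arbitrary: R) (auto simp: bypass_collision_def)
  with assms show ?thesis unfolding closure_def by blast
qed

lemma arrow_into_G':
  assumes "bypass_transmitting t (joined G) y False z True" "y \<in> U" "z \<in> U"
  shows "(y, z) \<in> arrows G'"
proof -
  have c: "closure y False z True" by (rule bypass_transmitting_closure) fact
  have "y \<noteq> z" using closure_tail[OF c _ assms(2)] summary_facts(6) by blast
  with closure_G'[OF c] assms(2,3) show ?thesis by (auto simp flip: joined_simps)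
qed

text \<open>No node of the directed path reaches \<open>s\<close>, so all of them except
  \<open>t\<close> lie in \<open>U\<close>. Since \<open>t\<close> is not in \<open>G'\<close>, the
  claim for a path starting at \<open>t\<close> concerns the parents of \<open>t\<close>, whose
  arrows bypass \<open>t\<close>.\<close>

lemma reach_G':
  assumes "(y, z) \<in> (arrows G)\<^sup>*" "z \<noteq> t" "y \<in> u" "(y, s) \<notin> (arrows G)\<^sup>*"
  shows "(y \<noteq> t \<longrightarrow> (y, z) \<in> (arrows G')\<^sup>*) \<and>
    (y = t \<longrightarrow> (\<forall>w \<in> U. (w, t) \<in> arrows G \<longrightarrow> (w, z) \<in> (arrows G')\<^sup>*))"
  using assms(1,3,4)
proof (induction rule: converse_rtrancl_induct)
  case base
  then show ?case using assms(2) by simp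
next
  case (step y y1)
  have y1: "y1 \<in> u" "(y1, s) \<notin> (arrows G)\<^sup>*"
    using step summary_facts(5) by (blast, meson converse_rtrancl_into_rtrancl)
  note IH = step.IH[OF y1]
  show ?case
  proof (cases "y = t")
    case True
    then have "y1 \<noteq> t" using step.hyps(1) summary_facts(6) by blast
    then have "y1 \<in> U" using y1 by (simp add: U_iff)
    have "(w, z) \<in> (arrows G')\<^sup>*" if w: "w \<in> U" "(w, t) \<in> arrows G" for w
    proof -
      have "joined G w False t True" "joined G t False y1 True" "w \<noteq> t"
        using w step.hyps(1) True by (auto simp: joined_simps U_iff)
      with \<open>y1 \<noteq> t\<close> have "bypass_transmitting t (joined G) w False y1 True"
        unfolding bypass_transmitting_def by blast
      with w \<open>y1 \<in> U\<close> have "(w, y1) \<in> arrows G'" by (blast intro: arrow_into_G')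
      with IH \<open>y1 \<noteq> t\<close> show ?thesis by (meson converse_rtrancl_into_rtrancl)
    qed
    with True show ?thesis by blast
  next
    case False
    then have y: "y \<in> U" using step.prems by (simp add: U_iff)
    show ?thesis
    proof (cases "y1 = t")
      case True
      with IH y step.hyps(1) False show ?thesis by blast
    next
      case y1t: False
      have "y1 \<in> U" using y1 y1t by (simp add: U_iff)
      moreover have "bypass_transmitting t (joined G) y False y1 True"
        using step.hyps(1) False y1t by (simp add: bypass_transmitting_def joined_simps)
      ultimately have "(y, y1) \<in> arrows G'" using y by (blast intro: arrow_into_G')
      with IH y1t False show ?thesis by (meson converse_rtrancl_into_rtrancl)
    qed
  qed
qed

text \<open>Nodes of \<open>U\<close> do not reach \<open>s\<close>, so adding \<open>s\<close> to
  \<open>c\<close> activates none of them, and their reachability of \<open>c\<close> survives the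
  elimination of \<open>t\<close>.\<close>

lemma act_U_iff:
  assumes "y \<in> U" "c \<subseteq> U \<union> V"
  shows "y \<in> act G' c \<longleftrightarrow> y \<in> act G (c \<union> {s})"
proof
  assume "y \<in> act G' c"
  then show "y \<in> act G (c \<union> {s})"
    unfolding act_iff using reach_G[OF _ assms(1)] by blast
next
  assume "y \<in> act G (c \<union> {s})"
  moreover have y: "y \<in> u" "y \<noteq> t" "(y, s) \<notin> (arrows G)\<^sup>*" using assms(1) by (auto simp: U_iff)
  ultimately obtain z where z: "z \<in> c" "(y, z) \<in> (arrows G)\<^sup>*" unfolding act_iff by blast
  with assms(2) have "z \<noteq> t" unfolding U_V by blast
  with reach_G'[OF z(2)] y z(1) show "y \<in> act G' c" unfolding act_iff by blast
qed

section \<open>Transfer of open walks between \<open>G'\<close> and \<open>G\<close>\<close>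

lemma js_act: "set js \<subseteq> act G (c \<union> {s})"
  by (auto simp: set_js_iff act_iff)

text \<open>Each edge is replaced by its source in \<open>closure\<close> and that by an open walk
  of \<open>G\<close>. The last mark is tracked only in \<open>U\<close>, since nodes of
  \<open>V\<close> outside \<open>c\<close> can be passed with any marks.\<close>

lemma walk_G'_G:
  assumes c: "c \<subseteq> U \<union> V" and "open_walk (joined G') (act G' c) c x a y b"
  shows "\<exists>a' b'. open_walk (joined G) (act G (c \<union> {s})) (c \<union> {s}) x a' y b' \<and> (y \<in> U \<longrightarrow> b' = b)"
  using assms(2)
proof (induction)
  have t: "t \<notin> c \<union> {s}" using c s_neq_t unfolding U_V by blast
  note walk = closure_walk[OF _ js_act t]
  {
    case (edge y b)
    from G'_edge(6)[OF this] show ?case by (blast dest: walk)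
  next
    case (snoc y b m z d)
    obtain a' b' where w: "open_walk (joined G) (act G (c \<union> {s})) (c \<union> {s}) x a' y b'"
      "y \<in> U \<longrightarrow> b' = b" using snoc.IH by blast
    obtain m' d' where e: "closure y m' z d'" "y \<in> U \<longrightarrow> m' = m" "z \<in> U \<longrightarrow> d' = d"
      using G'_edge(6)[OF snoc.hyps(3)] by blast
    have y: "y \<in> U \<union> V" using G'_edge(1)[OF snoc.hyps(3)] .
    then have "y \<noteq> s" unfolding U_V by blast
    have "passable (act G (c \<union> {s})) (c \<union> {s}) b' y m'"
    proof (cases "y \<in> U")
      case True
      with w e snoc.hyps(2) act_U_iff[OF True c] \<open>y \<noteq> s\<close> show ?thesis
        by (auto simp: passable_def split: if_splits)
    next
      case False
      \<comment> \<open>At \<open>V\<close> all marks of \<open>G'\<close> are tails, so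
        \<open>y\<close> is outside \<open>c\<close> and may transmit. A head \<open>m'\<close> puts
        \<open>y\<close> into \<open>u\<close>, hence into \<open>js\<close>, so a collision is open
        as well.\<close>
      with y have V: "y \<in> V" by blast
      then have "\<not> m" using G'_edge(4)[OF snoc.hyps(3)] by blast
      with snoc.hyps(2) \<open>y \<noteq> s\<close> have "y \<notin> c \<union> {s}" by (simp add: passable_def)
      moreover have "y \<in> act G (c \<union> {s})" if m'
        using closure_head[OF e(1)] that V_u[OF V] js_act by blast
      ultimately show ?thesis by (auto simp: passable_def)
    qed
    from open_walk_append[OF walk[OF e(1)] w(1) this] e(3) show ?case by blast
  }
qed

text \<open>Cutting out loops may empty the walk or change its last mark. At a node of
  \<open>U\<close> a loop has two heads, and cutting it may leave a tail \<open>b'\<close> instead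
  of the head \<open>b\<close>; then \<open>y\<close> is outside \<open>c\<close>, so the walk may
  go on with any mark.\<close>

lemma walk_closure_G':
  assumes c: "c \<subseteq> U \<union> V" and x: "x \<in> U \<union> V"
    and "open_walk closure (act G (c \<union> {s}) - set js) (c \<union> {s}) x a y b"
  shows "y \<in> U \<union> V \<longrightarrow> x = y \<or> (\<exists>a' b'. open_walk (joined G') (act G' c) c x a' y b' \<and>
    (y \<in> U \<longrightarrow> b' = b \<or> \<not> b' \<and> y \<notin> c))"
  using assms(3)
proof (induction)
  case (edge y b)
  show ?case
  proof (cases "x = y")
    case False
    show ?thesis
    proof
      assume "y \<in> U \<union> V"
      from closure_G'[OF edge False x this] obtain a' b' where
        e: "joined G' x a' y b'" "y \<in> U \<longrightarrow> b' = b" by blast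
      from e(1) have "open_walk (joined G') (act G' c) c x a' y b'" by (rule open_walk.edge)
      with e(2) show "x = y \<or> (\<exists>a' b'.
        open_walk (joined G') (act G' c) c x a' y b' \<and> (y \<in> U \<longrightarrow> b' = b \<or> \<not> b' \<and> y \<notin> c))" by blast
    qed
  qed simp
next
  case (snoc y b m z d)
  \<comment> \<open>\<open>s\<close> cannot transmit, being conditioned on, nor collide, as no
    collisions at \<open>js\<close> remain. So every inner node is a node of
    \<open>G'\<close>.\<close>
  have "s \<in> set js" using s_neq_t by (simp add: set_js)
  with snoc.hyps(2) have "y \<noteq> s" by (auto simp: passable_def split: if_splits)
  with closure_node[OF snoc.hyps(3)] have y: "y \<in> U \<union> V" unfolding U_V by blast
  show ?case
  proof (cases "y = z")
    case loop: True
    \<comment> \<open>A tail of the loop would give a directed cycle of \<open>G\<close>.\<close>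
    have md: "m \<and> d" if "z \<in> U"
      using closure_tail[OF snoc.hyps(3)] closure_tail[OF closure_sym[OF snoc.hyps(3)]]
        summary_facts(6)[of z] that loop by blast
    show ?thesis
    proof (cases "x = y")
      case False
      with snoc.IH y obtain a' b' where w: "open_walk (joined G') (act G' c) c x a' y b'"
        "y \<in> U \<longrightarrow> b' = b \<or> \<not> b' \<and> y \<notin> c" by blast
      have "y \<in> U \<longrightarrow> b' = d \<or> \<not> b' \<and> y \<notin> c"
        using w(2) md loop snoc.hyps(2) by (auto simp: passable_def split: if_splits)
      with w(1) loop show ?thesis by blast
    qed (use loop in simp)
  next
    case False
    show ?thesis
    proof
      assume z: "z \<in> U \<union> V"
      from closure_G'[OF snoc.hyps(3) False y z] obtain m' d' where
        e: "joined G' y m' z d'" "y \<in> U \<longrightarrow> m' = m" "z \<in> U \<longrightarrow> d' = d" by blast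
      show "x = z \<or> (\<exists>a' b'. open_walk (joined G') (act G' c) c x a' z b' \<and>
        (z \<in> U \<longrightarrow> b' = d \<or> \<not> b' \<and> z \<notin> c))"
      proof (cases "x = y")
        case True
        with e(1) have "open_walk (joined G') (act G' c) c x m' z d'" by (auto intro: open_walk.edge)
        with e(3) show ?thesis by blast
      next
        case False
        with snoc.IH y obtain a' b' where w: "open_walk (joined G') (act G' c) c x a' y b'"
          "y \<in> U \<longrightarrow> b' = b \<or> \<not> b' \<and> y \<notin> c" by blast
        have "passable (act G' c) c b' y m'"
        proof (cases "y \<in> U")
          case True
          with w(2) e(2) snoc.hyps(2) act_U_iff[OF True c] show ?thesis
            by (auto simp: passable_def split: if_splits)
        next
          case False
          \<comment> \<open>A collision at \<open>y\<close> would put \<open>y\<close> into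
            \<open>js\<close>, where none is allowed. So \<open>y\<close> transmits in the closure
            walk and is outside \<open>c\<close>.\<close>
          with y have V: "y \<in> V" by blast
          have "\<not> m'" using G'_edge(4)[OF e(1) V] .
          moreover have "y \<in> set js" if m
            using closure_head[OF snoc.hyps(3)] that V_u[OF V] by blast
          ultimately show ?thesis
            using snoc.hyps(2) by (auto simp: passable_def split: if_splits)
        qed
        with w(1) have "open_walk (joined G') (act G' c) c x a' z d'"
          using e(1) by (rule open_walk.snoc)
        with e(3) show ?thesis by blast
      qed
    qed
  qed
qed

lemma walk_G_G':
  assumes c: "c \<subseteq> U \<union> V" and x: "x \<in> U \<union> V" and y: "y \<in> U \<union> V" and "x \<noteq> y"
    and w: "open_walk (joined G) (act G (c \<union> {s})) (c \<union> {s}) x a y b"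
  shows "\<exists>a' b'. open_walk (joined G') (act G' c) c x a' y b'"
proof -
  have t: "x \<noteq> t" "y \<noteq> t" "t \<notin> c \<union> {s}" using x y c s_neq_t unfolding U_V by auto
  have child: "\<exists>w \<in> act G (c \<union> {s}). w \<noteq> t \<and> joined G t False w True"
    if "t \<in> act G (c \<union> {s})"
  proof -
    \<comment> \<open>\<open>t\<close> is not in \<open>c \<union> {s}\<close> itself, so a directed
      path into this set has a first arrow, whose end is the required child.\<close>
    from that t(3) obtain z where z: "z \<in> c \<union> {s}" "(t, z) \<in> (arrows G)\<^sup>*" "z \<noteq> t"
      unfolding act_iff by blast
    from z(2,3) obtain w where w: "(t, w) \<in> arrows G" "(w, z) \<in> (arrows G)\<^sup>*"
      by (auto elim: converse_rtranclE)
    have "w \<noteq> t" using w(1) summary_facts(6) by blast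
    moreover have "w \<in> act G (c \<union> {s})" using z(1) w(2) unfolding act_iff by blast
    ultimately show ?thesis using w(1) unfolding joined_simps by blast
  qed
  have no_loop: "\<not> joined G t a t b" for a b using summary_facts(2) by blast
  from open_walk_bypass_transmitting[OF w t(1) no_loop summary_facts(1) child] t(2)
  have "open_walk (bypass_transmitting t (joined G)) (act G (c \<union> {s})) (c \<union> {s}) x a y b"
    by blast
  then have "open_walk closure (act G (c \<union> {s}) - set js) (c \<union> {s}) x a y b"
    unfolding closure_def by (rule open_walk_bypass_collisions)
  from walk_closure_G'[OF c x this] y \<open>x \<noteq> y\<close> show ?thesis by auto
qed

lemma implies_indep_G':
  assumes "\<alpha> \<subseteq> U \<union> V" "\<beta> \<subseteq> U \<union> V" "c \<subseteq> U \<union> V" "\<alpha> \<inter> \<beta> = {}"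
  shows "implies_indep G' \<alpha> \<beta> c \<longleftrightarrow> implies_indep G \<alpha> \<beta> (c \<union> {s})"
proof -
  have "(\<exists>a b. open_walk (joined G') (act G' c) c x a y b) \<longleftrightarrow>
    (\<exists>a b. open_walk (joined G) (act G (c \<union> {s})) (c \<union> {s}) x a y b)"
    if "x \<in> \<alpha>" "y \<in> \<beta>" for x y
  proof -
    have "x \<in> U \<union> V" "y \<in> U \<union> V" "x \<noteq> y" using that assms by auto
    then show ?thesis using walk_G_G'[OF assms(3)] walk_G'_G[OF assms(3)] by blast
  qed
  then show ?thesis
    unfolding implies_indep_iff_open_walk[OF summary_graph_G' assms(4)]
      implies_indep_iff_open_walk[OF summary assms(4)] by blast
qed

end

theorem proposition1:
  fixes G G' :: "'a mgraph"
    and u v u' v' N' d\<^sub>s :: "'a set"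
    and s t :: 'a
    and js :: "'a list"
  assumes "summary_graph u v G"
    and "s \<in> nodes G" and "t \<in> nodes G" and "s \<noteq> t"
    and "N' = nodes G - {s, t}"
    and "d\<^sub>s = ancestors G s \<inter> u"
    and "v' = (v \<union> d\<^sub>s) - {s, t}"
    and "u' = N' - v'"
    and "distinct js"
    and "set js = {j. j \<noteq> t \<and> (j = s \<or> j \<in> ancestors G s)}"
    and "G' = delete_nodes {s, t} (reorient u' v' (close_edges t js G))"
  shows "nodes G' = N' \<and> summary_graph u' v' G' \<and>
    (\<forall>\<alpha> \<beta> c. \<alpha> \<subseteq> N' \<and> \<beta> \<subseteq> N' \<and> c \<subseteq> N' \<and>
       \<alpha> \<inter> \<beta> = {} \<and> \<alpha> \<inter> c = {} \<and> \<beta> \<inter> c = {} \<and> \<alpha> \<noteq> {} \<and> \<beta> \<noteq> {} \<longrightarrow>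
       (implies_indep G' \<alpha> \<beta> c \<longleftrightarrow> implies_indep G \<alpha> \<beta> (c \<union> {s})))"
proof -
  interpret M: marginalise_condition G u v s t js
    using assms by unfold_locales auto
  have v': "v' = M.V" using assms by (simp add: M.V_def)
  have u': "u' = M.U" using assms v' by (simp add: M.U_def)
  have G': "G' = M.G'" using assms u' v' by (simp add: M.G'_def M.H_def)
  have N': "N' = M.U \<union> M.V" using assms M.U_V by simp
  show ?thesis
    unfolding v' u' G' N'
    using M.nodes_G' M.summary_graph_G' M.implies_indep_G' by blast
qed

end
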